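(* Let $X$ and $Y$ be graphs on the same vertex set $V$, with $A = A(X)$ and $B=A(Y)$, and let $X \ltimes Y$ be the graph on vertex set $\{0,1\} \times V$ with adjacency matrix $\begin{pmatrix} A & B \\ B & A \end{pmatrix}$. Then $X \ltimes Y$ admits perfect state transfer if and only if one of the following holds. \begin{enumerate}[(i)] \item For some $\tau \in \mathbb{R}^+$, $\lambda \in \mathbb{C}$ and $u \in V$, the matrices $A+B$ and $A-B$ are periodic at $u$ at time $\tau$ with respective phase factors $+\lambda$ and $-\lambda$. In this case, perfect state transfer is between $(0,u)$ and $(1,u)$. \item For some $\tau \in \mathbb{R}^+$, $\lambda \in \mathbb{C}$ and $u ,v\in V$, the matrices $A+B$ and $A-B$ admit $uv$-perfect state transfer at time $\tau$ with the same phase factor $\lambda$. In this case, perfect state transfer is between $(0,u)$ and $(0,v)$, and between $(1,u)$ and $(1,v)$. \item For some $\tau \in \mathbb{R}^+$, $\lambda \in \mathbb{C}$ and $u ,v\in V$, the matrices $A+B$ and $A-B$ admit $uv$-perfect state transfer at time $\tau$ with respective phase factors $+\lambda$ and $-\lambda$. In this case, perfect state transfer is between $(0,u)$ and $(1,v)$, and between $(1,u)$ and $(0,v)$. \end{enumerate}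
   Context: For a symmetric matrix $M$, $U_M(t) = \exp(\mathrm{i} t M)$. $M$ admits perfect state transfer from $u$ to $v\neq u$ at time $\tau$ with phase $\lambda$ if $U_M(\tau)\mathbf{e}_u = \lambda \mathbf{e}_v$ (with $|\lambda|=1$); $M$ is periodic at $u$ at time $\tau\neq 0$ with phase $\lambda$ if $U_M(\tau)\mathbf{e}_u = \lambda \mathbf{e}_u$. A graph admits perfect state transfer if its adjacency matrix does between some pair of distinct vertices. *)

theory Defs
  imports "HOL-Analysis.Analysis"
begin

text \<open>A graph on the finite vertex type \<open>'v\<close> is given by its adjacency relation; graphs are
  undirected, without loops and without multiple edges.\<close>

definition simple_graph :: "('v \<Rightarrow> 'v \<Rightarrow> bool) \<Rightarrow> bool" where
  "simple_graph X \<longleftrightarrow> symp X \<and> irreflp X"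

definition adjacency_matrix :: "('v::finite \<Rightarrow> 'v \<Rightarrow> bool) \<Rightarrow> real^'v^'v" where
  "adjacency_matrix X = (\<chi> u v. if X u v then 1 else 0)"

text \<open>The two-element type \<open>2\<close>, whose elements are \<open>0\<close> and \<open>1\<close>, plays the role of \<open>{0,1}\<close>.\<close>

definition block_matrix :: "real^'v^'v \<Rightarrow> real^'v^'v \<Rightarrow> real^'v^'v \<Rightarrow> real^'v^'v \<Rightarrow>
    real^(2 \<times> 'v::finite)^(2 \<times> 'v)" where
  "block_matrix P Q R S = (\<chi> a b.
     (if fst a = 0 then (if fst b = 0 then P else Q) else (if fst b = 0 then R else S))
       $ snd a $ snd b)"

definition ltimes :: "('v \<Rightarrow> 'v \<Rightarrow> bool) \<Rightarrow> ('v \<Rightarrow> 'v \<Rightarrow> bool) \<Rightarrow> (2 \<times> 'v \<Rightarrow> 2 \<times> 'v \<Rightarrow> bool)"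
    (infixl \<open>\<ltimes>\<close> 70) where
  "(X \<ltimes> Y) a b = (if fst a = fst b then X (snd a) (snd b) else Y (snd a) (snd b))"

lemma simple_graph_ltimes:
  assumes "simple_graph X" "simple_graph Y"
  shows "simple_graph (X \<ltimes> Y)"
  using assms by (auto simp: simple_graph_def ltimes_def symp_def irreflp_def)

lemma adjacency_matrix_ltimes:
  "adjacency_matrix (X \<ltimes> Y) =
     block_matrix (adjacency_matrix X) (adjacency_matrix Y)
                  (adjacency_matrix Y) (adjacency_matrix X)"
proof -
  have "adjacency_matrix (X \<ltimes> Y) $ a $ b =
      block_matrix (adjacency_matrix X) (adjacency_matrix Y)
                   (adjacency_matrix Y) (adjacency_matrix X) $ a $ b" for a b
    using exhaust_2[of "fst a"] exhaust_2[of "fst b"]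
    by (elim disjE) (simp_all add: adjacency_matrix_def block_matrix_def ltimes_def)
  then show ?thesis
    unfolding vec_eq_iff by blast
qed

text \<open>The library's \<open>exp\<close> needs a normed algebra, and \<open>*\<close> and \<open>^\<close> on \<open>complex^'n^'n\<close> are
  entrywise; hence powers with respect to \<open>**\<close> and the exponential series are defined here.\<close>

primrec matrix_power :: "complex^'n^'n \<Rightarrow> nat \<Rightarrow> complex^'n^'n" where
  "matrix_power M 0 = mat 1"
| "matrix_power M (Suc k) = M ** matrix_power M k"

definition matrix_exp :: "complex^'n^'n \<Rightarrow> complex^'n^'n" where
  "matrix_exp M = (\<Sum>k. (1 / fact k) *\<^sub>R matrix_power M k)"

lemma norm_matrix_power_entry_le:
  fixes M :: "complex^'n^'n"
  assumes "\<And>i j. cmod (M $ i $ j) \<le> c"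
  shows "cmod (matrix_power M k $ i $ j) \<le> (of_nat CARD('n) * c) ^ k"
proof (induction k arbitrary: i j)
  case 0
  then show ?case by (simp add: mat_def)
next
  case (Suc k)
  have c: "0 \<le> c"
    using order_trans[OF norm_ge_zero assms] .
  have "cmod (matrix_power M (Suc k) $ i $ j) \<le> (\<Sum>l\<in>UNIV. cmod (M $ i $ l * matrix_power M k $ l $ j))"
    by (simp add: matrix_matrix_mult_def norm_sum)
  also have "\<dots> \<le> (\<Sum>l\<in>(UNIV :: 'n set). c * (of_nat CARD('n) * c) ^ k)"
    unfolding norm_mult by (intro sum_mono mult_mono assms Suc c norm_ge_zero)
  finally show ?case by (simp add: mult.assoc)
qed

lemma matrix_exp_sums: "(\<lambda>k. (1 / fact k) *\<^sub>R matrix_power M k) sums matrix_exp M"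
  for M :: "complex^'n^'n"
proof -
  define c where "c = Max (range (\<lambda>(i, j). cmod (M $ i $ j)))"
  have c: "cmod (M $ i $ j) \<le> c" for i j
    unfolding c_def by (intro Max_ge) (auto intro!: image_eqI[where x = "(i, j)"])
  let ?C = "of_nat CARD('n) * c"
  have "summable (\<lambda>k. (1 / fact k) *\<^sub>R matrix_power M k $ i $ j)" for i j
  proof (rule summable_comparison_test')
    show "summable (\<lambda>k. inverse (fact k) * ?C ^ k)"
      by (rule summable_exp)
    show "norm ((1 / fact k) *\<^sub>R matrix_power M k $ i $ j) \<le> inverse (fact k) * ?C ^ k" for k
      using norm_matrix_power_entry_le[of M c k i j, OF c]
      by (simp add: divide_simps mult.commute)
  qed
  then have "(\<lambda>k. (1 / fact k) *\<^sub>R matrix_power M k) sums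
      (\<chi> i j. \<Sum>k. (1 / fact k) *\<^sub>R matrix_power M k $ i $ j)"
    unfolding sums_def
    by (intro vec_tendstoI) (simp add: summable_LIMSEQ)
  then show ?thesis
    unfolding matrix_exp_def by (rule sums_summable[THEN summable_sums])
qed

definition transition_matrix :: "real^'n^'n \<Rightarrow> real \<Rightarrow> complex^'n^'n" where
  "transition_matrix M t = matrix_exp (\<chi> i j. \<i> * complex_of_real t * complex_of_real (M $ i $ j))"

definition pst :: "real^'n^'n \<Rightarrow> 'n \<Rightarrow> 'n \<Rightarrow> real \<Rightarrow> complex \<Rightarrow> bool" where
  "pst M u v \<tau> \<gamma> \<longleftrightarrow>
     u \<noteq> v \<and> cmod \<gamma> = 1 \<and> transition_matrix M \<tau> *v axis u 1 = \<gamma> *s axis v 1"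

definition periodic_at :: "real^'n^'n \<Rightarrow> 'n \<Rightarrow> real \<Rightarrow> complex \<Rightarrow> bool" where
  "periodic_at M u \<tau> \<gamma> \<longleftrightarrow>
     \<tau> \<noteq> 0 \<and> transition_matrix M \<tau> *v axis u 1 = \<gamma> *s axis u 1"

definition pst_between :: "real^'n^'n \<Rightarrow> 'n \<Rightarrow> 'n \<Rightarrow> real \<Rightarrow> complex \<Rightarrow> bool" where
  "pst_between M u v \<tau> \<gamma> \<longleftrightarrow> pst M u v \<tau> \<gamma> \<and> pst M v u \<tau> \<gamma>"

definition admits_pst :: "('v::finite \<Rightarrow> 'v \<Rightarrow> bool) \<Rightarrow> bool" where
  "admits_pst X \<longleftrightarrow> (\<exists>u v \<tau> \<gamma>. pst (adjacency_matrix X) u v \<tau> \<gamma>)"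

end

theory Submission
  imports Defs
begin

text \<open>Conjugating by the Hadamard matrix of order two turns the adjacency matrix of \<open>X \<ltimes> Y\<close> into
  \<open>(A + B) \<oplus> (A - B)\<close>, so its transition matrix has the blocks \<open>(P + Q) / 2\<close> on the diagonal and
  \<open>(P - Q) / 2\<close> off it, where \<open>P\<close> and \<open>Q\<close> are the transition matrices of \<open>A + B\<close> and \<open>A - B\<close>.
  Comparing columns gives the three cases. Transition matrices of symmetric matrices are symmetric
  and unitary, which makes perfect state transfer symmetric and forces phases to have modulus one;
  \<open>U(-t) = cnj (U(t))\<close> disposes of negative times.\<close>

section \<open>Powers of real matrices with complexified entries\<close>

text \<open>With the scalar \<open>\<i> * t\<close> taken out, the powers no longer depend on
  \<open>t\<close>, so the exponential becomes a power series in \<open>\<i> * t\<close>.\<close>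

definition complex_matrix :: "real^'n^'m \<Rightarrow> complex^'n^'m" where
  "complex_matrix M = (\<chi> i j. complex_of_real (M $ i $ j))"

lemma complex_matrix_component [simp]: "complex_matrix M $ i $ j = complex_of_real (M $ i $ j)"
  by (simp add: complex_matrix_def)

lemma matrix_power_scale:
  "matrix_power (\<chi> i j. c * N $ i $ j) k = (\<chi> i j. c ^ k * matrix_power N k $ i $ j)"
  by (induction k)
    (auto simp: vec_eq_iff mat_def matrix_matrix_mult_def sum_distrib_left intro!: sum.cong)

lemma matrix_power_add: "matrix_power N (k + l) = matrix_power N k ** matrix_power N l"
  by (induction k) (simp_all add: matrix_mul_assoc)

lemma transpose_matrix_power: "transpose (matrix_power N k) = matrix_power (transpose N) k"
proof (induction k)
  case (Suc k)
  then show ?case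
    \<comment> \<open>The recursion peels a factor off the left, while transposing leaves it on the
      right; splitting the exponent as \<open>k + 1\<close> gives that form.\<close>
    using matrix_power_add[of "transpose N" k 1] by (simp add: matrix_transpose_mul)
qed (simp add: transpose_mat)

lemma cnj_matrix_power:
  "cnj (matrix_power (complex_matrix M) k $ i $ j) = matrix_power (complex_matrix M) k $ i $ j"
  by (induction k arbitrary: i j) (simp_all add: mat_def matrix_matrix_mult_def complex_matrix_def)

text \<open>Absolute convergence is what the Cauchy product in \<open>transition_matrix_add\<close>
  requires. The entry bound grows only geometrically in \<open>k\<close>, so an exponential series
  dominates.\<close>

lemma summable_norm_matrix_power:
  fixes N :: "complex^'n^'n"
  shows "summable (\<lambda>k. cmod (z ^ k / fact k * matrix_power N k $ i $ j))"
proof -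
  define c where "c = Max (range (\<lambda>(i, j). cmod (N $ i $ j)))"
  have c: "cmod (N $ i $ j) \<le> c" for i j
    unfolding c_def by (intro Max_ge) (auto intro!: image_eqI[where x = "(i, j)"])
  let ?C = "cmod z * (of_nat CARD('n) * c)"
  show ?thesis
  proof (rule summable_comparison_test')
    show "summable (\<lambda>k. inverse (fact k) * ?C ^ k)"
      by (rule summable_exp)
    show "norm (cmod (z ^ k / fact k * matrix_power N k $ i $ j)) \<le> inverse (fact k) * ?C ^ k" for k
    proof -
      have "cmod z ^ k / fact k * cmod (matrix_power N k $ i $ j)
          \<le> cmod z ^ k / fact k * (of_nat CARD('n) * c) ^ k"
        by (intro mult_left_mono norm_matrix_power_entry_le c) simp
      then show ?thesis
        by (simp add: norm_mult norm_divide norm_power norm_inverse power_mult_distrib divide_simps mult_ac)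
    qed
  qed
qed

section \<open>The transition matrix as an entrywise power series\<close>

text \<open>By uniqueness of limits, identities between transition matrices reduce to identities
  between the terms of these series.\<close>

lemma transition_matrix_sums:
  "(\<lambda>k. (\<i> * complex_of_real t) ^ k / fact k * matrix_power (complex_matrix M) k $ i $ j)
     sums transition_matrix M t $ i $ j"
proof -
  let ?N = "\<chi> i j. \<i> * complex_of_real t * complex_of_real (M $ i $ j)"
  have N: "?N = (\<chi> i j. \<i> * complex_of_real t * complex_matrix M $ i $ j)"
    by (simp add: complex_matrix_def)
  have "(\<lambda>k. ((1 / fact k) *\<^sub>R matrix_power ?N k) $ i $ j) sums (matrix_exp ?N $ i $ j)"
    using matrix_exp_sums[of ?N] unfolding sums_def sum_component[symmetric]
    by (intro tendsto_vec_nth)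
  then show ?thesis
    unfolding transition_matrix_def N matrix_power_scale
    by (simp add: scaleR_conv_of_real[where 'a = complex])
qed

lemma transition_matrix_0: "transition_matrix M 0 = mat 1"
proof -
  have "transition_matrix M 0 $ i $ j = mat 1 $ i $ j" for i j
    using transition_matrix_sums[of 0 M i j]
      powser_sums_zero[of "\<lambda>k. matrix_power (complex_matrix M) k $ i $ j / fact k"]
    by (simp add: sums_unique2 mult.commute)
  then show ?thesis
    unfolding vec_eq_iff by blast
qed

text \<open>In the Cauchy product of the entry series, the \<open>m\<close>-th and
  \<open>(k - m)\<close>-th powers multiply to the \<open>k\<close>-th power for every
  \<open>m\<close>; this factors out, and the binomial theorem sums the remaining scalars.\<close>

lemma transition_matrix_add:
  "transition_matrix M s ** transition_matrix M t = transition_matrix M (s + t)"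
proof -
  let ?p = "\<lambda>k i j. matrix_power (complex_matrix M) k $ i $ j"
  let ?f = "\<lambda>t k i j. (\<i> * complex_of_real t) ^ k / fact k * ?p k i j"
  have "(transition_matrix M s ** transition_matrix M t) $ i $ j = transition_matrix M (s + t) $ i $ j"
    for i j
  proof (rule sums_unique2)
    have "(\<lambda>k. \<Sum>l\<in>UNIV. \<Sum>m\<le>k. ?f s m i l * ?f t (k - m) l j) sums
        (\<Sum>l\<in>UNIV. transition_matrix M s $ i $ l * transition_matrix M t $ l $ j)"
    proof (rule sums_sum)
      fix l
      show "(\<lambda>k. \<Sum>m\<le>k. ?f s m i l * ?f t (k - m) l j) sums
          (transition_matrix M s $ i $ l * transition_matrix M t $ l $ j)"
        unfolding transition_matrix_sums[THEN sums_unique]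
        by (rule Cauchy_product_sums) (rule summable_norm_matrix_power)+
    qed
    then show "(\<lambda>k. \<Sum>l\<in>UNIV. \<Sum>m\<le>k. ?f s m i l * ?f t (k - m) l j) sums
        ((transition_matrix M s ** transition_matrix M t) $ i $ j)"
      by (simp add: matrix_matrix_mult_def)
    have "(\<Sum>l\<in>UNIV. \<Sum>m\<le>k. ?f s m i l * ?f t (k - m) l j) = ?f (s + t) k i j" for k
    proof -
      have "(\<Sum>l\<in>UNIV. \<Sum>m\<le>k. ?f s m i l * ?f t (k - m) l j)
          = (\<Sum>m\<le>k. (\<i> * s) ^ m / fact m * ((\<i> * t) ^ (k - m) / fact (k - m)) *
              (\<Sum>l\<in>UNIV. ?p m i l * ?p (k - m) l j))"
        by (subst sum.swap) (simp add: sum_distrib_left sum_divide_distrib mult_ac)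
      also have "\<dots> = (\<Sum>m\<le>k. (\<i> * s) ^ m / fact m * ((\<i> * t) ^ (k - m) / fact (k - m))) * ?p k i j"
        unfolding sum_distrib_right
      proof (intro sum.cong refl)
        fix m assume "m \<in> {..k}"
        then have "(\<Sum>l\<in>UNIV. ?p m i l * ?p (k - m) l j) = ?p k i j"
          using matrix_power_add[of "complex_matrix M" m "k - m"]
          by (simp add: matrix_matrix_mult_def)
        then show "(\<i> * s) ^ m / fact m * ((\<i> * t) ^ (k - m) / fact (k - m)) *
            (\<Sum>l\<in>UNIV. ?p m i l * ?p (k - m) l j) =
            (\<i> * s) ^ m / fact m * ((\<i> * t) ^ (k - m) / fact (k - m)) * ?p k i j"
          by simp
      qed
      also have "(\<Sum>m\<le>k. (\<i> * s) ^ m / fact m * ((\<i> * t) ^ (k - m) / fact (k - m)))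
          = (\<i> * complex_of_real (s + t)) ^ k / fact k"
        \<comment> \<open>This is the binomial theorem divided by \<open>fact k\<close>.\<close>
        using exp_series_add_commuting[of "\<i> * complex_of_real s" "\<i> * complex_of_real t" k]
        by (simp add: scaleR_conv_of_real divide_inverse algebra_simps)
      finally show ?thesis .
    qed
    then show "(\<lambda>k. \<Sum>l\<in>UNIV. \<Sum>m\<le>k. ?f s m i l * ?f t (k - m) l j) sums
        (transition_matrix M (s + t) $ i $ j)"
      using transition_matrix_sums[of "s + t" M i j] by simp
  qed
  then show ?thesis
    unfolding vec_eq_iff by blast
qed

text \<open>The powers have real entries, so conjugation only turns \<open>\<i>\<close> into
  \<open>- \<i>\<close>, which amounts to reversing time.\<close>

lemma cnj_transition_matrix:
  "cnj (transition_matrix M t $ i $ j) = transition_matrix M (- t) $ i $ j"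
proof (rule sums_unique2)
  have "(\<lambda>k. cnj ((\<i> * t) ^ k / fact k * matrix_power (complex_matrix M) k $ i $ j))
      sums cnj (transition_matrix M t $ i $ j)"
    unfolding sums_cnj by (rule transition_matrix_sums)
  then show "(\<lambda>k. (\<i> * complex_of_real (- t)) ^ k / fact k * matrix_power (complex_matrix M) k $ i $ j)
      sums cnj (transition_matrix M t $ i $ j)"
    by (simp add: cnj_matrix_power)
qed (rule transition_matrix_sums)

section \<open>Symmetry and unitarity\<close>

lemma transition_matrix_sym:
  assumes "transpose M = M"
  shows "transition_matrix M t $ i $ j = transition_matrix M t $ j $ i"
proof -
  have "transpose (complex_matrix M) = complex_matrix M"
    using assms by (simp add: complex_matrix_def transpose_def vec_eq_iff)
  then have "transpose (matrix_power (complex_matrix M) k) = matrix_power (complex_matrix M) k" for k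
    by (simp add: transpose_matrix_power)
  then have "matrix_power (complex_matrix M) k $ i $ j = matrix_power (complex_matrix M) k $ j $ i" for k
    by (simp add: transpose_def vec_eq_iff)
  then show ?thesis
    using transition_matrix_sums[of t M i j] transition_matrix_sums[of t M j i]
    by (simp add: sums_unique2)
qed

text \<open>Symmetry and \<open>cnj_transition_matrix\<close> turn entry \<open>(i, j)\<close> of
  \<open>U(t) ** U(-t) = mat 1\<close> into the inner product of columns \<open>i\<close> and
  \<open>j\<close>.\<close>

lemma transition_matrix_unitary:
  assumes "transpose M = M"
  shows "(\<Sum>k\<in>UNIV. transition_matrix M t $ k $ i * cnj (transition_matrix M t $ k $ j)) =
    (if i = j then 1 else 0)"
proof -
  have "transition_matrix M t ** transition_matrix M (- t) = mat 1"
    by (simp add: transition_matrix_add transition_matrix_0)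
  then have "(transition_matrix M t ** transition_matrix M (- t)) $ i $ j = mat 1 $ i $ j"
    by simp
  then show ?thesis
    by (simp add: matrix_matrix_mult_def mat_def cnj_transition_matrix
        transition_matrix_sym[OF assms, of t i])
qed

section \<open>State transfer as a condition on columns\<close>

lemma mult_axis_eq_iff:
  fixes U :: "'a::comm_semiring_1^'n^'m"
  shows "U *v axis u 1 = \<gamma> *s axis v 1 \<longleftrightarrow> (\<forall>w. U $ w $ u = (if w = v then \<gamma> else 0))"
  by (auto simp: vec_eq_iff matrix_vector_mul_component axis_def matrix_vector_mult_def if_distrib cong: if_cong)

text \<open>A column of a unitary matrix has norm one, and here \<open>\<gamma>\<close> is its only
  possibly nonzero entry. This supplies the unit phase when transfer is derived from
  periodicity.\<close>

lemma transition_column_cmod: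
  assumes "transpose M = M" "transition_matrix M t *v axis u 1 = \<gamma> *s axis v 1"
  shows "cmod \<gamma> = 1"
proof -
  have "\<gamma> * cnj \<gamma> = 1"
  proof -
    have "transition_matrix M t $ k $ u = (if k = v then \<gamma> else 0)" for k
      using assms(2) by (simp add: mult_axis_eq_iff)
    note col = this
    show ?thesis
      using transition_matrix_unitary[OF assms(1), of t u u] unfolding col
      by (simp add: if_distrib cong: if_cong)
  qed
  then have "(cmod \<gamma>)\<^sup>2 = 1"
    by (metis complex_mod_mult_cnj norm_one)
  then show ?thesis
    by (simp add: power2_eq_1_iff) (smt (verit) norm_ge_zero)
qed

text \<open>Since column \<open>u\<close> is concentrated at \<open>v\<close>, its inner product
  with column \<open>w\<close> involves only the entry at \<open>(v, w)\<close>. Orthonormality thus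
  determines row \<open>v\<close>, and symmetry makes it column \<open>v\<close>.\<close>

lemma transition_column_swap:
  assumes "transpose M = M" "transition_matrix M t *v axis u 1 = \<gamma> *s axis v 1"
  shows "transition_matrix M t *v axis v 1 = \<gamma> *s axis u 1"
proof -
  have col: "transition_matrix M t $ k $ u = (if k = v then \<gamma> else 0)" for k
    using assms(2) by (simp add: mult_axis_eq_iff)
  have "transition_matrix M t $ v $ w * cnj \<gamma> = (if w = u then 1 else 0)" for w
    using transition_matrix_unitary[OF assms(1), of t w u]
    by (simp add: col if_distrib cong: if_cong)
  moreover have "cnj \<gamma> * \<gamma> = 1"
    using transition_column_cmod[OF assms] by (simp add: complex_norm_square[symmetric] mult.commute)
  ultimately have "transition_matrix M t $ v $ w = (if w = u then \<gamma> else 0)" for w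
    by (metis mult.assoc mult.right_neutral mult_1 mult_zero_left)
  then show ?thesis
    by (simp add: mult_axis_eq_iff transition_matrix_sym[OF assms(1), of t _ v])
qed

lemma transition_column_uminus:
  assumes "transition_matrix M t *v axis u 1 = \<gamma> *s axis v 1"
  shows "transition_matrix M (- t) *v axis u 1 = cnj \<gamma> *s axis v 1"
  using assms by (simp add: mult_axis_eq_iff flip: cnj_transition_matrix)

lemma pst_between_iff_pst:
  "transpose M = M \<Longrightarrow> pst_between M u v t \<gamma> \<longleftrightarrow> pst M u v t \<gamma>"
  unfolding pst_between_def pst_def using transition_column_swap by blast

lemma transpose_adjacency_matrix:
  "simple_graph X \<Longrightarrow> transpose (adjacency_matrix X) = adjacency_matrix X"
  by (auto simp: simple_graph_def symp_def transpose_def adjacency_matrix_def vec_eq_iff)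

text \<open>Time zero is excluded because an off-diagonal entry of the identity would have to be a
  unit phase; negative times are reversed by conjugating the phase.\<close>

lemma admits_pst_iff_pos:
  "admits_pst X \<longleftrightarrow> (\<exists>u v t \<gamma>. t > 0 \<and> pst (adjacency_matrix X) u v t \<gamma>)"
proof
  assume "admits_pst X"
  then obtain u v t \<gamma> where p: "pst (adjacency_matrix X) u v t \<gamma>"
    by (auto simp: admits_pst_def)
  have "t \<noteq> 0"
  proof
    assume "t = 0"
    then have "mat 1 $ v $ u = \<gamma>"
      using p unfolding pst_def mult_axis_eq_iff by (simp add: transition_matrix_0)
    with p show False
      by (auto simp: pst_def mat_def)
  qed
  then consider "t > 0" | "- t > 0"
    by linarith
  then show "\<exists>u v t \<gamma>. t > 0 \<and> pst (adjacency_matrix X) u v t \<gamma>"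
  proof cases
    case 2
    moreover have "pst (adjacency_matrix X) u v (- t) (cnj \<gamma>)"
      using p by (simp add: pst_def transition_column_uminus)
    ultimately show ?thesis by blast
  qed (use p in blast)
qed (auto simp: admits_pst_def)

section \<open>Decomposition of the block matrix\<close>

lemma neq_iff_2: "b \<noteq> a \<longleftrightarrow> b = 1 - a" for a b :: 2
  using exhaust_2[of a] exhaust_2[of b] by auto

text \<open>Splitting at an arbitrary \<open>a\<close>, with \<open>1 - a\<close> as the other
  index, treats both block rows at once.\<close>

lemma sum_UNIV_2_times:
  fixes f :: "2 \<times> 'v::finite \<Rightarrow> 'a::comm_monoid_add"
  shows "(\<Sum>p\<in>UNIV. f p) = (\<Sum>w\<in>UNIV. f (a, w)) + (\<Sum>w\<in>UNIV. f (1 - a, w))"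
proof -
  have U: "UNIV = {a, 1 - a}" "a \<noteq> 1 - a"
    using neq_iff_2 by blast+
  have "(\<Sum>p\<in>UNIV. f p) = (\<Sum>b\<in>UNIV. \<Sum>w\<in>UNIV. f (b, w))"
    unfolding UNIV_Times_UNIV[symmetric] by (simp add: sum.cartesian_product)
  then show ?thesis
    unfolding U(1) using U(2) by simp
qed

lemma block_matrix_component:
  "block_matrix A B B A $ (a, u) $ (b, v) = (if a = b then A $ u $ v else B $ u $ v)"
  using exhaust_2[of a] exhaust_2[of b] by (auto simp: block_matrix_def)

text \<open>This is the Hadamard conjugation at the level of powers, proved by induction without
  introducing the conjugating matrix.\<close>

lemma matrix_power_block_matrix:
  "matrix_power (complex_matrix (block_matrix A B B A)) k $ (a, u) $ (b, v) =
    (matrix_power (complex_matrix (A + B)) k $ u $ v +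
      (if a = b then 1 else - 1) * matrix_power (complex_matrix (A - B)) k $ u $ v) / 2"
proof (induction k arbitrary: a u)
  case 0
  then show ?case by (auto simp: mat_def)
next
  case (Suc k)
  let ?s = "if a = b then 1 else - 1 :: complex"
  let ?p = "\<lambda>w. matrix_power (complex_matrix (A + B)) k $ w $ v"
  let ?q = "\<lambda>w. matrix_power (complex_matrix (A - B)) k $ w $ v"
  have neq: "a \<noteq> 1 - a" and s: "(if 1 - a = b then 1 else - 1) = - ?s"
    using neq_iff_2[of a "1 - a"] neq_iff_2[of b a] by (simp_all only: simp_thms if_True if_False minus_minus) auto
  \<comment> \<open>Row block \<open>a\<close> meets itself through \<open>A\<close> and the other
    block through \<open>B\<close>, where the sign flips. Regrouping by \<open>?p\<close> and
    \<open>?q\<close> then produces \<open>A + B\<close> and \<open>A - B\<close>.\<close>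
  have "matrix_power (complex_matrix (block_matrix A B B A)) (Suc k) $ (a, u) $ (b, v) =
      (\<Sum>w\<in>UNIV. A $ u $ w * ((?p w + ?s * ?q w) / 2) + B $ u $ w * ((?p w + - ?s * ?q w) / 2))"
    using neq by (simp only: matrix_power.simps matrix_matrix_mult_def vec_lambda_beta
        sum_UNIV_2_times[of _ a] Suc s sum.distrib complex_matrix_component block_matrix_component
        simp_thms if_True if_False)
  also have "\<dots> = (\<Sum>w\<in>UNIV. ((A $ u $ w + B $ u $ w) * ?p w + ?s * ((A $ u $ w - B $ u $ w) * ?q w)) / 2)"
    by (intro sum.cong refl) (simp add: field_simps)
  also have "\<dots> = (matrix_power (complex_matrix (A + B)) (Suc k) $ u $ v +
      ?s * matrix_power (complex_matrix (A - B)) (Suc k) $ u $ v) / 2"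
    by (simp add: matrix_matrix_mult_def sum.distrib
        flip: sum_distrib_left sum_divide_distrib split del: if_split)
  finally show ?case .
qed

lemma transition_matrix_block_matrix:
  "transition_matrix (block_matrix A B B A) t $ (a, u) $ (b, v) =
    (transition_matrix (A + B) t $ u $ v +
      (if a = b then 1 else - 1) * transition_matrix (A - B) t $ u $ v) / 2"
proof -
  let ?s = "if a = b then 1 else - 1 :: complex"
  let ?c = "\<lambda>k. (\<i> * complex_of_real t) ^ k / fact k"
  have "(\<lambda>k. (?c k * matrix_power (complex_matrix (A + B)) k $ u $ v +
        ?s * (?c k * matrix_power (complex_matrix (A - B)) k $ u $ v)) / 2)
      sums ((transition_matrix (A + B) t $ u $ v + ?s * transition_matrix (A - B) t $ u $ v) / 2)"
    by (intro sums_divide sums_add sums_mult transition_matrix_sums)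
  moreover have "(?c k * matrix_power (complex_matrix (A + B)) k $ u $ v +
        ?s * (?c k * matrix_power (complex_matrix (A - B)) k $ u $ v)) / 2 =
      ?c k * matrix_power (complex_matrix (block_matrix A B B A)) k $ (a, u) $ (b, v)" for k
    unfolding matrix_power_block_matrix by (simp add: algebra_simps)
  ultimately show ?thesis
    using transition_matrix_sums[of t "block_matrix A B B A" "(a, u)" "(b, v)"]
    by (simp only: sums_unique2)
qed

text \<open>The half-sum and half-difference of the columns of \<open>A + B\<close> and
  \<open>A - B\<close> are the two halves of the block column. Inverting this, the sum of the halves
  of the target is always \<open>\<gamma>\<close> at \<open>v\<close>, while their difference
  carries a sign recording whether the block changes.\<close>

lemma transition_column_block_matrix:
  "transition_matrix (block_matrix A B B A) t *v axis (a, u) 1 = \<gamma> *s axis (b, v) 1 \<longleftrightarrow>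
    transition_matrix (A + B) t *v axis u 1 = \<gamma> *s axis v 1 \<and>
    transition_matrix (A - B) t *v axis u 1 = (if a = b then \<gamma> else - \<gamma>) *s axis v 1"
  (is "?L \<longleftrightarrow> ?R")
proof -
  let ?P = "\<lambda>w. transition_matrix (A + B) t $ w $ u" and ?Q = "\<lambda>w. transition_matrix (A - B) t $ w $ u"
  let ?d = "\<lambda>c w. if c = b \<and> w = v then \<gamma> else 0"
  have "?L \<longleftrightarrow> (\<forall>w. (?P w + ?Q w) / 2 = ?d a w \<and> (?P w - ?Q w) / 2 = ?d (1 - a) w)"
  proof -
    have "(\<forall>p. F p) \<longleftrightarrow> (\<forall>w. F (a, w) \<and> F (1 - a, w))" for F :: "2 \<times> 'a \<Rightarrow> bool"
      using neq_iff_2[of _ a] by (metis surj_pair)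
    moreover have "1 - a \<noteq> a"
      using neq_iff_2 by blast
    ultimately show ?thesis
      by (simp only: mult_axis_eq_iff transition_matrix_block_matrix prod.inject simp_thms
          if_True if_False mult_1 mult_minus_left diff_conv_add_uminus)
  qed
  also have "\<dots> \<longleftrightarrow> ?R"
  proof -
    have "1 - a = b \<longleftrightarrow> a \<noteq> b"
      using neq_iff_2 by metis
    moreover have "(x + y) / 2 = p \<and> (x - y) / 2 = q \<longleftrightarrow> x = p + q \<and> y = p - q" for x y p q :: complex
    proof -
      have "x = (x + y) / 2 + (x - y) / 2" "y = (x + y) / 2 - (x - y) / 2"
        by (simp_all flip: add_divide_distrib diff_divide_distrib)
      then show ?thesis by auto
    qed
    ultimately show ?thesis
      by (auto simp: mult_axis_eq_iff)
  qed
  finally show ?thesis .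
qed

section \<open>Transfer in \<open>X \<ltimes> Y\<close>\<close>

theorem theorem12:
  fixes X Y :: "'v::finite \<Rightarrow> 'v \<Rightarrow> bool" and A B :: "real^'v^'v"
  assumes "simple_graph X" and "simple_graph Y"
    and "A = adjacency_matrix X" and "B = adjacency_matrix Y"
  shows "(admits_pst (X \<ltimes> Y) \<longleftrightarrow>
      (\<exists>\<tau> \<gamma> u. \<tau> > 0 \<and> periodic_at (A + B) u \<tau> \<gamma> \<and> periodic_at (A - B) u \<tau> (-\<gamma>))
    \<or> (\<exists>\<tau> \<gamma> u v. \<tau> > 0 \<and> pst (A + B) u v \<tau> \<gamma> \<and> pst (A - B) u v \<tau> \<gamma>)
    \<or> (\<exists>\<tau> \<gamma> u v. \<tau> > 0 \<and> pst (A + B) u v \<tau> \<gamma> \<and> pst (A - B) u v \<tau> (-\<gamma>)))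
    \<and> (\<forall>\<tau> \<gamma> u. \<tau> > 0 \<longrightarrow>
         (periodic_at (A + B) u \<tau> \<gamma> \<and> periodic_at (A - B) u \<tau> (-\<gamma>)
            \<longleftrightarrow> pst_between (adjacency_matrix (X \<ltimes> Y)) (0, u) (1, u) \<tau> \<gamma>))
    \<and> (\<forall>\<tau> \<gamma> u v. \<tau> > 0 \<and> u \<noteq> v \<longrightarrow>
         (pst (A + B) u v \<tau> \<gamma> \<and> pst (A - B) u v \<tau> \<gamma>
            \<longleftrightarrow> pst_between (adjacency_matrix (X \<ltimes> Y)) (0, u) (0, v) \<tau> \<gamma>)
       \<and> (pst (A + B) u v \<tau> \<gamma> \<and> pst (A - B) u v \<tau> \<gamma>
            \<longleftrightarrow> pst_between (adjacency_matrix (X \<ltimes> Y)) (1, u) (1, v) \<tau> \<gamma>))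
    \<and> (\<forall>\<tau> \<gamma> u v. \<tau> > 0 \<and> u \<noteq> v \<longrightarrow>
         (pst (A + B) u v \<tau> \<gamma> \<and> pst (A - B) u v \<tau> (-\<gamma>)
            \<longleftrightarrow> pst_between (adjacency_matrix (X \<ltimes> Y)) (0, u) (1, v) \<tau> \<gamma>)
       \<and> (pst (A + B) u v \<tau> \<gamma> \<and> pst (A - B) u v \<tau> (-\<gamma>)
            \<longleftrightarrow> pst_between (adjacency_matrix (X \<ltimes> Y)) (1, u) (0, v) \<tau> \<gamma>))"
proof -
  let ?L = "adjacency_matrix (X \<ltimes> Y)"
  have symL: "transpose ?L = ?L"
    using assms by (simp add: transpose_adjacency_matrix simple_graph_ltimes)
  have "transpose A = A" "transpose B = B"
    using assms by (simp_all add: transpose_adjacency_matrix)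
  then have symAB: "transpose (A + B) = A + B"
    by (simp add: transpose_def vec_eq_iff)
  \<comment> \<open>All three cases are instances of this equivalence: \<open>a \<noteq> b\<close>
    with \<open>u = v\<close>, \<open>a = b\<close>, and \<open>a \<noteq> b\<close> with
    \<open>u \<noteq> v\<close>.\<close>
  have L: "pst_between ?L (a, u) (b, v) t \<gamma> \<longleftrightarrow> (a, u) \<noteq> (b, v) \<and> cmod \<gamma> = 1 \<and>
      transition_matrix (A + B) t *v axis u 1 = \<gamma> *s axis v 1 \<and>
      transition_matrix (A - B) t *v axis u 1 = (if a = b then \<gamma> else - \<gamma>) *s axis v 1"
    for a b u v t \<gamma>
    unfolding pst_between_iff_pst[OF symL] pst_def
    unfolding adjacency_matrix_ltimes assms(3,4) transition_column_block_matrix ..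
  have i: "periodic_at (A + B) u t \<gamma> \<and> periodic_at (A - B) u t (- \<gamma>) \<longleftrightarrow>
      pst_between ?L (a, u) (b, u) t \<gamma>" if "t > 0" "a \<noteq> b" for a b u t \<gamma>
    \<comment> \<open>\<open>periodic_at\<close> does not state that the phase has modulus one;
      unitarity for \<open>A + B\<close> provides it.\<close>
    using that transition_column_cmod[OF symAB] by (auto simp: L periodic_at_def)
  have ii: "pst (A + B) u v t \<gamma> \<and> pst (A - B) u v t \<gamma> \<longleftrightarrow> pst_between ?L (a, u) (a, v) t \<gamma>"
    for a u v t \<gamma>
    by (auto simp: L pst_def)
  have iii: "pst (A + B) u v t \<gamma> \<and> pst (A - B) u v t (- \<gamma>) \<longleftrightarrow> pst_between ?L (a, u) (b, v) t \<gamma>"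
    if "a \<noteq> b" "u \<noteq> v" for a b u v t \<gamma>
    using that by (auto simp: L pst_def)
  let ?i = "\<exists>\<tau> \<gamma> u. \<tau> > 0 \<and> periodic_at (A + B) u \<tau> \<gamma> \<and> periodic_at (A - B) u \<tau> (-\<gamma>)"
  let ?ii = "\<exists>\<tau> \<gamma> u v. \<tau> > 0 \<and> pst (A + B) u v \<tau> \<gamma> \<and> pst (A - B) u v \<tau> \<gamma>"
  let ?iii = "\<exists>\<tau> \<gamma> u v. \<tau> > 0 \<and> pst (A + B) u v \<tau> \<gamma> \<and> pst (A - B) u v \<tau> (-\<gamma>)"
  have admits: "admits_pst (X \<ltimes> Y) \<longleftrightarrow> (\<exists>p q t \<gamma>. t > 0 \<and> pst_between ?L p q t \<gamma>)"
    unfolding admits_pst_iff_pos pst_between_iff_pst[OF symL] ..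
  have "admits_pst (X \<ltimes> Y) \<longleftrightarrow> ?i \<or> ?ii \<or> ?iii"
  proof
    assume "admits_pst (X \<ltimes> Y)"
    then obtain a u b v t \<gamma> where t: "t > 0" and p: "pst_between ?L (a, u) (b, v) t \<gamma>"
      unfolding admits by (metis surj_pair)
    \<comment> \<open>When \<open>a = b\<close>, distinctness of the two vertices already forces
      \<open>u \<noteq> v\<close>.\<close>
    consider "a = b" | "a \<noteq> b" "u = v" | "a \<noteq> b" "u \<noteq> v"
      by blast
    then show "?i \<or> ?ii \<or> ?iii"
    proof cases
      case 1
      then show ?thesis using t p ii by blast
    next
      case 2
      then show ?thesis using t p i by blast
    next
      case 3
      then show ?thesis using t p iii by blast
    qed
  next
    \<comment> \<open>The indices \<open>0\<close> and \<open>1\<close> serve as the distinct blocks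
      that \<open>i\<close> and \<open>iii\<close> ask for.\<close>
    have "(0::2) \<noteq> 1"
      by simp
    moreover assume "?i \<or> ?ii \<or> ?iii"
    ultimately show "admits_pst (X \<ltimes> Y)"
      unfolding admits using i ii iii pst_def by metis
  qed
  then show ?thesis
    using i[of _ 0 1] ii[of _ _ _ _ 0] ii[of _ _ _ _ 1] iii[of 0 1] iii[of 1 0] by simp
qed

end
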